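(* Let $L$ be a Markov operator acting on two normed vector spaces $(B_s,\|\cdot\|_s)$, $(B_w,\|\cdot\|_w)$ with $B_s\subseteq B_w\subseteq CM(X)$ and $\|\cdot\|_s\ge\|\cdot\|_w$. Suppose: (1) (Lasota-Yorke inequality) there are $A,B\ge0$ and $0\le\lambda_1<1$ such that for each $g\in B_s$ and each $n$, $\|L^ng\|_s\le A\lambda_1^n\|g\|_s+B\|g\|_w$; (2) (convergence to equilibrium) for each $g\in V_s$, $\lim_{n\to\infty}\|L^ng\|_w=0$; (3) (compact inclusion) $V_s$ is compactly immersed in $V_w$; more precisely, for each $\epsilon>0$ the unit ball of $(V_s,\|\cdot\|_s)$ has a finite $\epsilon$-net for the norm $\|\cdot\|_w$; (4) (weak boundedness) $\sup_n\|L^n|_{V_s}\|_w<\infty$. If $(B_s,\|\cdot\|_s)$ is a Banach space, then $L$ has spectral gap (as an operator $B_s\to B_s$).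
   Context: $X$ is a metric space and $CM(X)$ is the set of Borel complex valued measures on $X$. A Markov operator is a linear operator that maps positive measures to positive measures and satisfies $[L\mu](X)=\mu(X)$ for each $\mu$. $V_s=\{g\in B_s: g(X)=0\}$ and $V_w=\{g\in B_w: g(X)=0\}$ are the strong and weak spaces of zero average measures. In (4), $\|L^n|_{V_s}\|_w=\sup\{\|L^ng\|_w: g\in V_s,\ \|g\|_w\le1\}$ is the weak norm of $L^n$ restricted to $V_s$. Spectral notions refer to operators on complex Banach spaces: the spectral radius $\rho(N)$ is the supremum of $|z|$ over $z$ in the spectrum of $N$, and an operator $L:B\to B$ has spectral gap if $L=\lambda P+N$, where $P$ is a projection ($P^2=P$) with $\dim(\mathrm{Im}\,P)=1$, the spectral radius of $N$ satisfies $\rho(N)<|\lambda|$, and $PN=NP=0$.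
   Formalization: The formal theorem also assumes that some g in B_s has g(X) ≠ 0 (so V_s ≠ B_s); without this the claim fails, e.g. for B_s = B_w = span(δ_x − δ_y) with Lμ = μ(X)δ_x, where L = 0 on B_s. *)

theory Defs
  imports "HOL-Analysis.Analysis" "HOL-Library.Function_Algebras"
begin

type_synonym 'a set_fun = "'a set \<Rightarrow> complex"

definition cscale :: "complex \<Rightarrow> 'a set_fun \<Rightarrow> 'a set_fun"  (infixr \<open>*\<^sub>c\<close> 75)
  where "c *\<^sub>c \<mu> = (\<lambda>A. c * \<mu> A)"

global_interpretation cvec: vector_space "cscale :: complex \<Rightarrow> 'a set_fun \<Rightarrow> 'a set_fun"
  defines csubspace = cvec.subspace and cdim = cvec.dim
  by unfold_locales (auto simp: cscale_def fun_eq_iff algebra_simps)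

text \<open>Values outside the Borel sets are normalised to 0, so that equality of measures is
  equality of functions.\<close>

definition complex_measures :: "'a::metric_space set_fun set"
  where "complex_measures =
    {\<mu>. (\<forall>A. A \<notin> sets borel \<longrightarrow> \<mu> A = 0) \<and>
        (\<forall>A::nat \<Rightarrow> 'a set. range A \<subseteq> sets borel \<longrightarrow> disjoint_family A \<longrightarrow>
           (\<lambda>i. \<mu> (A i)) sums \<mu> (\<Union>i. A i))}"

definition positive_measure :: "'a::metric_space set_fun \<Rightarrow> bool"
  where "positive_measure \<mu> \<longleftrightarrow> \<mu> \<in> complex_measures \<and> (\<forall>A\<in>sets borel. \<mu> A \<in> \<real>\<^sub>\<ge>\<^sub>0)"

definition zero_average :: "'a set_fun set \<Rightarrow> 'a set_fun set"
  where "zero_average B = {g \<in> B. g UNIV = 0}"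

text \<open>Normed spaces are given by a carrier and a norm function; the values of the norm and
  of operators outside the carrier are irrelevant.\<close>

definition normed_space_on :: "'a set_fun set \<Rightarrow> ('a set_fun \<Rightarrow> real) \<Rightarrow> bool"
  where "normed_space_on B nrm \<longleftrightarrow> csubspace B \<and>
    (\<forall>v\<in>B. 0 \<le> nrm v \<and> (nrm v = 0 \<longleftrightarrow> v = 0)) \<and>
    (\<forall>c. \<forall>v\<in>B. nrm (c *\<^sub>c v) = cmod c * nrm v) \<and>
    (\<forall>v\<in>B. \<forall>w\<in>B. nrm (v + w) \<le> nrm v + nrm w)"

definition banach_space_on :: "'a set_fun set \<Rightarrow> ('a set_fun \<Rightarrow> real) \<Rightarrow> bool"
  where "banach_space_on B nrm \<longleftrightarrow> normed_space_on B nrm \<and>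
    (\<forall>u::nat \<Rightarrow> 'a set_fun. (\<forall>n. u n \<in> B) \<longrightarrow>
       (\<forall>e>0. \<exists>N. \<forall>m\<ge>N. \<forall>n\<ge>N. nrm (u m - u n) < e) \<longrightarrow>
       (\<exists>v\<in>B. (\<lambda>n. nrm (u n - v)) \<longlonglongrightarrow> 0))"

definition linear_operator_on :: "'a set_fun set \<Rightarrow> ('a set_fun \<Rightarrow> 'a set_fun) \<Rightarrow> bool"
  where "linear_operator_on B T \<longleftrightarrow>
    (\<forall>v\<in>B. T v \<in> B) \<and>
    (\<forall>v\<in>B. \<forall>w\<in>B. T (v + w) = T v + T w) \<and>
    (\<forall>c. \<forall>v\<in>B. T (c *\<^sub>c v) = c *\<^sub>c T v)"

definition bounded_operator_on ::
    "'a set_fun set \<Rightarrow> ('a set_fun \<Rightarrow> real) \<Rightarrow> ('a set_fun \<Rightarrow> 'a set_fun) \<Rightarrow> bool"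
  where "bounded_operator_on B nrm T \<longleftrightarrow>
    linear_operator_on B T \<and> (\<exists>C. \<forall>v\<in>B. nrm (T v) \<le> C * nrm v)"

definition markov_operator_on ::
    "'a::metric_space set_fun set \<Rightarrow> ('a set_fun \<Rightarrow> 'a set_fun) \<Rightarrow> bool"
  where "markov_operator_on B L \<longleftrightarrow> linear_operator_on B L \<and>
    (\<forall>\<mu>\<in>B. positive_measure \<mu> \<longrightarrow> positive_measure (L \<mu>)) \<and>
    (\<forall>\<mu>\<in>B. L \<mu> UNIV = \<mu> UNIV)"

text \<open>Operator norm with respect to \<open>nrm\<close> of the restriction of \<open>T\<close> to \<open>V\<close>; the value
  is \<open>\<infinity>\<close> if the restriction is unbounded.\<close>

definition restricted_opnorm ::
    "('a set_fun \<Rightarrow> real) \<Rightarrow> 'a set_fun set \<Rightarrow> ('a set_fun \<Rightarrow> 'a set_fun) \<Rightarrow> ennreal"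
  where "restricted_opnorm nrm V T = (SUP g\<in>{g \<in> V. nrm g \<le> 1}. ennreal (nrm (T g)))"

definition spectrum_on ::
    "'a set_fun set \<Rightarrow> ('a set_fun \<Rightarrow> real) \<Rightarrow> ('a set_fun \<Rightarrow> 'a set_fun) \<Rightarrow> complex set"
  where "spectrum_on B nrm T =
    {z. \<not> (\<exists>R. bounded_operator_on B nrm R \<and>
              (\<forall>v\<in>B. R (z *\<^sub>c v - T v) = v \<and> z *\<^sub>c R v - T (R v) = v))}"

definition spectral_radius_on ::
    "'a set_fun set \<Rightarrow> ('a set_fun \<Rightarrow> real) \<Rightarrow> ('a set_fun \<Rightarrow> 'a set_fun) \<Rightarrow> ennreal"
  where "spectral_radius_on B nrm T = (SUP z\<in>spectrum_on B nrm T. ennreal (cmod z))"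

definition has_spectral_gap ::
    "'a set_fun set \<Rightarrow> ('a set_fun \<Rightarrow> real) \<Rightarrow> ('a set_fun \<Rightarrow> 'a set_fun) \<Rightarrow> bool"
  where "has_spectral_gap B nrm L \<longleftrightarrow>
    (\<exists>(l::complex) P N.
       bounded_operator_on B nrm P \<and> bounded_operator_on B nrm N \<and>
       (\<forall>v\<in>B. L v = l *\<^sub>c P v + N v) \<and>
       (\<forall>v\<in>B. P (P v) = P v) \<and> cdim (P ` B) = 1 \<and>
       spectral_radius_on B nrm N < ennreal (cmod l) \<and>
       (\<forall>v\<in>B. P (N v) = 0 \<and> N (P v) = 0))"

end

theory Submission
  imports Defs
begin

text \<open>
  The gap comes from one estimate: on the zero average space \<open>V\<close> of \<open>B\<^sub>s\<close> the powers of \<open>L\<close> decay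
  geometrically in the strong norm. Convergence to equilibrium makes each weak orbit on \<open>V\<close> tend
  to 0. By weak boundedness the powers of \<open>L\<close> are equicontinuous for the weak norm, so a finite
  net of the strong unit ball turns this pointwise convergence into a uniform one
  (\<open>uniform_weak_decay\<close>). The Lasota-Yorke inequality, applied after such a weakly contracting
  power, then yields \<open>N\<close> with \<open>\<parallel>L\<^sup>N g\<parallel>\<^sub>s \<le> \<parallel>g\<parallel>\<^sub>s / 2\<close> on \<open>V\<close> (\<open>halving_power\<close>); together with the
  uniform bound \<open>A + B\<close> on all powers this gives \<open>\<parallel>L\<^sup>n g\<parallel>\<^sub>s \<le> D r\<^sup>n \<parallel>g\<parallel>\<^sub>s\<close> with \<open>r < 1\<close>.

  The total mass \<open>g \<mapsto> g(X)\<close> is not assumed to be continuous for the strong norm, so \<open>V\<close> is not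
  closed for trivial reasons. It is closed because the decay estimate extends to the closure of \<open>V\<close>:
  for \<open>g\<close> in that closure the Neumann series gives \<open>s \<in> B\<^sub>s\<close> with \<open>g = s - L s\<close>, and \<open>L\<close> preserves mass,
  so \<open>g(X) = 0\<close> (\<open>banach_zero_average\<close>).

  Now take \<open>g\<^sub>0\<close> of mass 1 and solve \<open>s - L s = L g\<^sub>0 - g\<^sub>0\<close> in the Banach space \<open>V\<close>; then \<open>h = g\<^sub>0 + s\<close> is
  a fixed point of mass 1. Put \<open>P g = g(X) h\<close> and \<open>N = L - P\<close>. Since \<open>g - P g \<in> V\<close>, the iterates
  \<open>L\<^sup>n g\<close> converge to \<open>P g\<close>, which bounds \<open>P\<close>, and \<open>N\<^sup>n = L\<^sup>n (I - P)\<close> for \<open>n \<ge> 1\<close> decays like \<open>r\<^sup>n\<close>.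
  A further Neumann series shows that the spectrum of \<open>N\<close> lies in the disc of radius \<open>r\<close>
  (\<open>spectral_gap_if_decay_on_zero_average\<close>).
\<close>

section \<open>Normed spaces on a carrier\<close>

locale normed_carrier =
  fixes B :: "'a set_fun set" and nrm :: "'a set_fun \<Rightarrow> real"
  assumes normed: "normed_space_on B nrm"
begin

lemma subspace: "csubspace B"
  using normed by (simp add: normed_space_on_def)

lemma zero_mem [simp]: "0 \<in> B"
  using subspace by (rule cvec.subspace_0)

lemma add_mem [simp]: "v \<in> B \<Longrightarrow> w \<in> B \<Longrightarrow> v + w \<in> B"
  using subspace by (rule cvec.subspace_add)

lemma diff_mem [simp]: "v \<in> B \<Longrightarrow> w \<in> B \<Longrightarrow> v - w \<in> B"
  using subspace by (rule cvec.subspace_diff)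

lemma scale_mem [simp]: "v \<in> B \<Longrightarrow> c *\<^sub>c v \<in> B"
  using subspace by (rule cvec.subspace_scale)

lemma norm_nonneg [simp]: "v \<in> B \<Longrightarrow> 0 \<le> nrm v"
  using normed by (simp add: normed_space_on_def)

lemma norm_eq_0_iff: "v \<in> B \<Longrightarrow> nrm v = 0 \<longleftrightarrow> v = 0"
  using normed by (simp add: normed_space_on_def)

lemma norm_zero [simp]: "nrm 0 = 0"
  by (simp add: norm_eq_0_iff)

lemma norm_scale: "v \<in> B \<Longrightarrow> nrm (c *\<^sub>c v) = cmod c * nrm v"
  using normed by (simp add: normed_space_on_def)

lemma norm_add: "v \<in> B \<Longrightarrow> w \<in> B \<Longrightarrow> nrm (v + w) \<le> nrm v + nrm w"
  using normed by (simp add: normed_space_on_def)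

lemma norm_minus_commute:
  assumes "v \<in> B" "w \<in> B"
  shows "nrm (v - w) = nrm (w - v)"
proof -
  have "v - w = (-1) *\<^sub>c (w - v)" by (auto simp: cscale_def fun_eq_iff)
  then show ?thesis using assms norm_scale[of "w - v" "-1"] by simp
qed

lemma norm_diff: "v \<in> B \<Longrightarrow> w \<in> B \<Longrightarrow> nrm (v - w) \<le> nrm v + nrm w"
  using norm_add[of v "0 - w"] norm_minus_commute[of 0 w] diff_mem[of 0 w] by simp

lemma norm_triangle: 
  assumes "u \<in> B" "v \<in> B" "w \<in> B"
  shows "nrm (u - w) \<le> nrm (u - v) + nrm (v - w)"
  using norm_add[of "u - v" "v - w"] assms by simp

lemma norm_le_add_dist: "v \<in> B \<Longrightarrow> w \<in> B \<Longrightarrow> nrm v \<le> nrm w + nrm (v - w)"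
  using norm_add[of w "v - w"] by simp

lemma norm_sum_le: "(\<And>i. i \<in> I \<Longrightarrow> u i \<in> B) \<Longrightarrow> nrm (\<Sum>i\<in>I. u i) \<le> (\<Sum>i\<in>I. nrm (u i))"
proof (induction I rule: infinite_finite_induct)
  case (insert x F)
  then have "nrm (u x + sum u F) \<le> nrm (u x) + nrm (sum u F)"
    by (intro norm_add) (auto intro: cvec.subspace_sum[OF subspace])
  also have "\<dots> \<le> nrm (u x) + (\<Sum>i\<in>F. nrm (u i))" using insert by simp
  finally show ?case unfolding sum.insert[OF insert.hyps] .
qed auto

lemma eq_if_dist_tendsto_0:
  assumes "v \<in> B" "w \<in> B" "\<And>n. nrm (v - w) \<le> a n" "a \<longlonglongrightarrow> 0"
  shows "v = w"
proof -
  have "nrm (v - w) \<le> 0" by (rule LIMSEQ_le_const[OF assms(4)]) (use assms in auto)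
  then have "nrm (v - w) = 0" using norm_nonneg[of "v - w"] assms by (intro antisym) auto
  then show ?thesis using norm_eq_0_iff[of "v - w"] assms(1,2) by auto
qed

end

section \<open>Linear operators and their powers\<close>

lemma linear_operator_on_memD: "linear_operator_on B T \<Longrightarrow> v \<in> B \<Longrightarrow> T v \<in> B"
  by (simp add: linear_operator_on_def)

lemma linear_operator_on_addD:
  "linear_operator_on B T \<Longrightarrow> v \<in> B \<Longrightarrow> w \<in> B \<Longrightarrow> T (v + w) = T v + T w"
  by (simp add: linear_operator_on_def)

lemma linear_operator_on_scaleD:
  "linear_operator_on B T \<Longrightarrow> v \<in> B \<Longrightarrow> T (c *\<^sub>c v) = c *\<^sub>c T v"
  by (simp add: linear_operator_on_def)

lemma linear_operator_on_zeroD: "linear_operator_on B T \<Longrightarrow> csubspace B \<Longrightarrow> T 0 = 0"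
  using linear_operator_on_scaleD[of B T 0 0] cvec.subspace_0[of B] by simp

lemma linear_operator_on_diffD:
  assumes "linear_operator_on B T" "csubspace B" "v \<in> B" "w \<in> B"
  shows "T (v - w) = T v - T w"
proof -
  have "T v = T ((v - w) + w)" by simp
  also have "\<dots> = T (v - w) + T w"
    by (rule linear_operator_on_addD[OF assms(1)]) (use assms cvec.subspace_diff in auto)
  finally show ?thesis by simp
qed

lemma linear_operator_on_sumD:
  assumes "linear_operator_on B T" "csubspace B" "\<And>i. i \<in> I \<Longrightarrow> u i \<in> B"
  shows "T (\<Sum>i\<in>I. u i) = (\<Sum>i\<in>I. T (u i))"
  using assms(3)
proof (induction I rule: infinite_finite_induct)
  case (insert x F)
  then have "T (u x + sum u F) = T (u x) + T (sum u F)"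
    by (intro linear_operator_on_addD[OF assms(1)]) (auto intro: cvec.subspace_sum[OF assms(2)])
  also have "\<dots> = T (u x) + (\<Sum>i\<in>F. T (u i))" using insert by simp
  finally show ?case unfolding sum.insert[OF insert.hyps] .
qed (auto intro: linear_operator_on_zeroD[OF assms(1,2)])

lemma linear_operator_on_funpow:
  "linear_operator_on B T \<Longrightarrow> linear_operator_on B (T ^^ n)"
  by (induction n) (auto simp: linear_operator_on_def)

lemma funpow_scaled:
  assumes "linear_operator_on B T" "v \<in> B"
  shows "((\<lambda>x. c *\<^sub>c T x) ^^ n) v = c ^ n *\<^sub>c (T ^^ n) v"
proof (induction n)
  case (Suc n)
  have "(T ^^ n) v \<in> B" using assms by (metis linear_operator_on_funpow linear_operator_on_memD)
  with Suc show ?case using assms by (simp add: linear_operator_on_scaleD[of B])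
qed simp

lemma bounded_operator_on_tendsto:
  assumes "normed_space_on B nrm" "bounded_operator_on B nrm T"
    and "\<And>n. u n \<in> B" "s \<in> B" "(\<lambda>n. nrm (u n - s)) \<longlonglongrightarrow> 0"
  shows "(\<lambda>n. nrm (T (u n) - T s)) \<longlonglongrightarrow> 0"
proof -
  interpret normed_carrier B nrm by unfold_locales fact
  obtain C where lin: "linear_operator_on B T" and C: "\<And>v. v \<in> B \<Longrightarrow> nrm (T v) \<le> C * nrm v"
    using assms(2) by (auto simp: bounded_operator_on_def)
  have eq: "T (u n) - T s = T (u n - s)" for n
    using linear_operator_on_diffD[OF lin subspace] assms by simp
  show ?thesis
    by (rule tendsto_sandwich[OF _ _ tendsto_const tendsto_mult_right_zero[OF assms(5), of C]])
      (use assms C linear_operator_on_memD[OF lin] eq in \<open>auto intro!: always_eventually\<close>)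
qed

section \<open>Neumann series\<close>

text \<open>The bound on the limit is kept because it is what bounds the resolvent later on.\<close>

lemma geometric_series_converges:
  assumes ban: "banach_space_on B nrm"
    and mem: "\<And>k. u k \<in> B"
    and le: "\<And>k. nrm (u k) \<le> K * r ^ k" and r: "0 \<le> r" "r < 1"
  shows "\<exists>s\<in>B. (\<lambda>n. nrm ((\<Sum>k<n. u k) - s)) \<longlonglongrightarrow> 0 \<and> nrm s \<le> K / (1 - r)"
proof -
  interpret normed_carrier B nrm
    by unfold_locales (use ban in \<open>simp add: banach_space_on_def\<close>)
  define S where "S n = (\<Sum>k<n. u k)" for n
  have Smem: "S n \<in> B" for n
    unfolding S_def by (intro cvec.subspace_sum[OF subspace]) (use mem in auto)
  have K: "0 \<le> K" using le[of 0] norm_nonneg[OF mem[of 0]] by simp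
  have geom: "(\<Sum>k=m..<n. K * r ^ k) \<le> K / (1 - r) * r ^ m" if "m \<le> n" for m n
  proof -
    have "(\<Sum>k=m..<n. K * r ^ k) = (\<Sum>k<n - m. K * r ^ (k + m))"
      using that by (intro sum.reindex_bij_witness[of _ "\<lambda>k. k + m" "\<lambda>k. k - m"]) auto
    also have "\<dots> = K * r ^ m * (\<Sum>k<n - m. r ^ k)"
      by (simp add: sum_distrib_left power_add algebra_simps)
    also have "(\<Sum>k<n - m. r ^ k) = (1 - r ^ (n - m)) / (1 - r)"
      using r by (simp add: sum_gp_strict)
    also have "K * r ^ m * \<dots> \<le> K * r ^ m * (1 / (1 - r))"
      using r K by (intro mult_left_mono divide_right_mono) auto
    finally show ?thesis by simp
  qed
  have dist: "nrm (S n - S m) \<le> K / (1 - r) * r ^ m" if "m \<le> n" for m n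
  proof -
    have "S n - S m = (\<Sum>k=m..<n. u k)"
      unfolding S_def using that
      by (metis sum_diff_nat_ivl atLeast0LessThan zero_le)
    then have "nrm (S n - S m) \<le> (\<Sum>k=m..<n. nrm (u k))"
      using norm_sum_le[of "{m..<n}" u] mem by simp
    also have "\<dots> \<le> (\<Sum>k=m..<n. K * r ^ k)" by (intro sum_mono le)
    finally show ?thesis using geom[OF that] by simp
  qed
  have lim: "(\<lambda>m. K / (1 - r) * r ^ m) \<longlonglongrightarrow> 0"
    using r by (intro tendsto_mult_right_zero LIMSEQ_power_zero) auto
  have cauchy: "\<exists>N. \<forall>m\<ge>N. \<forall>n\<ge>N. nrm (S m - S n) < e" if "e > 0" for e
  proof -
    from order_tendstoD(2)[OF lim that] obtain N
      where N: "\<And>m. m \<ge> N \<Longrightarrow> K / (1 - r) * r ^ m < e"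
      by (auto simp: eventually_sequentially)
    have "nrm (S m - S n) < e" if "m \<ge> N" "n \<ge> N" for m n
      using dist[of m n] dist[of n m] N[of m] N[of n] that norm_minus_commute[OF Smem Smem, of m n]
      by (cases "m \<le> n") auto
    then show ?thesis by blast
  qed
  then obtain s where s: "s \<in> B" "(\<lambda>n. nrm (S n - s)) \<longlonglongrightarrow> 0"
    using ban Smem unfolding banach_space_on_def by blast
  have "nrm s \<le> K / (1 - r) + nrm (S n - s)" for n
    using norm_le_add_dist[OF s(1) Smem[of n]] norm_minus_commute[OF s(1) Smem[of n]]
      dist[of 0 n] by (simp add: S_def)
  then have "nrm s \<le> K / (1 - r)"
    by (intro LIMSEQ_le_const[OF tendsto_add[OF tendsto_const s(2), of "K / (1 - r)", simplified]]) auto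
  with s show ?thesis unfolding S_def by blast
qed

text \<open>The solution is \<open>s = \<Sum>n. T\<^sup>n v\<close>: the partial sums satisfy \<open>S\<^sub>n - T S\<^sub>n = v - T\<^sup>n v\<close>, and \<open>T\<close> is continuous.
  Geometric decay is required of the single orbit of \<open>v\<close> only, so the lemma also applies to
  vectors of a space on which \<open>I - T\<close> is not invertible, such as points of the closure of the
  zero average space.\<close>

lemma neumann_solution:
  assumes ban: "banach_space_on B nrm" and bd: "bounded_operator_on B nrm T"
    and v: "v \<in> B" and le: "\<And>n. nrm ((T ^^ n) v) \<le> K * r ^ n" and r: "0 \<le> r" "r < 1"
  shows "\<exists>s\<in>B. s - T s = v \<and> nrm s \<le> K / (1 - r)"
proof -
  interpret normed_carrier B nrm
    by unfold_locales (use ban in \<open>simp add: banach_space_on_def\<close>)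
  have lin: "linear_operator_on B T" using bd by (simp add: bounded_operator_on_def)
  have mem: "(T ^^ n) v \<in> B" for n
    using linear_operator_on_memD[OF linear_operator_on_funpow[OF lin] v] .
  obtain s where s: "s \<in> B" "(\<lambda>n. nrm ((\<Sum>k<n. (T ^^ k) v) - s)) \<longlonglongrightarrow> 0" "nrm s \<le> K / (1 - r)"
    using geometric_series_converges[OF ban mem le r] by blast
  define S where "S n = (\<Sum>k<n. (T ^^ k) v)" for n
  have Smem: "S n \<in> B" for n
    unfolding S_def by (intro cvec.subspace_sum[OF subspace]) (use mem in auto)
  have Ts: "T s \<in> B" and TS: "T (S n) \<in> B" for n
    using linear_operator_on_memD[OF lin] s Smem by auto
  have telescope: "S n - T (S n) = v - (T ^^ n) v" for n
  proof -
    have "T (S n) = (\<Sum>k<n. (T ^^ Suc k) v)"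
      unfolding S_def using linear_operator_on_sumD[OF lin subspace, of "{..<n}" "\<lambda>k. (T ^^ k) v"] mem by simp
    then have "S n - T (S n) = (\<Sum>k<n. (T ^^ k) v - (T ^^ Suc k) v)"
      by (simp add: S_def sum_subtractf)
    also have "\<dots> = (T ^^ 0) v - (T ^^ n) v" by (rule sum_lessThan_telescope')
    finally show ?thesis by simp
  qed
  have S_lim: "(\<lambda>n. nrm (S n - s)) \<longlonglongrightarrow> 0" using s by (simp add: S_def)
  have TS_lim: "(\<lambda>n. nrm (T (S n) - T s)) \<longlonglongrightarrow> 0"
    by (rule bounded_operator_on_tendsto[OF normed bd Smem s(1) S_lim])
  have geo_lim: "(\<lambda>n. K * r ^ n) \<longlonglongrightarrow> 0"
    using r by (intro tendsto_mult_right_zero LIMSEQ_power_zero) auto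
  have "s - T s = v"
  proof (rule eq_if_dist_tendsto_0)
    fix n
    have eq: "(s - T s) - v = (T (S n) - T s) - (S n - s) - (T ^^ n) v"
      using telescope[of n] by (simp add: algebra_simps)
    show "nrm ((s - T s) - v) \<le> nrm (T (S n) - T s) + nrm (S n - s) + K * r ^ n"
      unfolding eq
      using norm_diff[of "T (S n) - T s - (S n - s)" "(T ^^ n) v"]
        norm_diff[of "T (S n) - T s" "S n - s"] le[of n] mem Smem s Ts TS by simp
    show "(\<lambda>n. nrm (T (S n) - T s) + nrm (S n - s) + K * r ^ n) \<longlonglongrightarrow> 0"
      using tendsto_add[OF tendsto_add[OF TS_lim S_lim] geo_lim] by simp
  qed (use s v Ts in auto)
  with s show ?thesis by blast
qed

text \<open>The operator \<open>T / z\<close> has geometrically decaying powers, so \<open>z x - T x = v\<close> is solvable by a Neumann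
  series with a norm bound. The same decay makes the solution unique, since a vector with
  \<open>T d = z d\<close> is fixed by all powers of \<open>T / z\<close>. Uniqueness is what makes the solution operator linear.\<close>

lemma not_in_spectrum_if_geometric:
  assumes ban: "banach_space_on B nrm" and bd: "bounded_operator_on B nrm T"
    and le: "\<And>n v. v \<in> B \<Longrightarrow> nrm ((T ^^ n) v) \<le> K * r ^ n * nrm v"
    and r: "0 \<le> r" "r < cmod z"
  shows "z \<notin> spectrum_on B nrm T"
proof -
  interpret normed_carrier B nrm
    by unfold_locales (use ban in \<open>simp add: banach_space_on_def\<close>)
  have lin: "linear_operator_on B T" using bd by (simp add: bounded_operator_on_def)
  have z: "z \<noteq> 0" using r by auto
  define q where "q = r / cmod z"
  have q: "0 \<le> q" "q < 1" using r z by (auto simp: q_def)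
  let ?T = "\<lambda>x. inverse z *\<^sub>c T x"
  have Tmem: "T v \<in> B" if "v \<in> B" for v using linear_operator_on_memD[OF lin that] .
  have bd': "bounded_operator_on B nrm ?T"
  proof -
    obtain C where C: "\<And>v. v \<in> B \<Longrightarrow> nrm (T v) \<le> C * nrm v"
      using bd by (auto simp: bounded_operator_on_def)
    have "nrm (?T v) \<le> (cmod (inverse z) * C) * nrm v" if "v \<in> B" for v
      using mult_left_mono[OF C[OF that], of "cmod (inverse z)"] norm_scale[OF Tmem[OF that]]
      by (simp add: mult.assoc)
    moreover have "linear_operator_on B ?T"
      using lin by (auto simp: linear_operator_on_def cvec.scale_right_distrib mult.commute)
    ultimately show ?thesis unfolding bounded_operator_on_def by blast
  qed
  have le': "nrm ((?T ^^ n) v) \<le> K * nrm v * q ^ n" if "v \<in> B" for v n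
  proof -
    have "nrm ((?T ^^ n) v) = cmod (inverse z ^ n) * nrm ((T ^^ n) v)"
      using funpow_scaled[OF lin that] norm_scale
        linear_operator_on_memD[OF linear_operator_on_funpow[OF lin] that] by simp
    also have "\<dots> \<le> cmod (inverse z ^ n) * (K * r ^ n * nrm v)"
      by (intro mult_left_mono le that) auto
    finally show ?thesis by (simp add: q_def norm_power norm_inverse norm_divide power_divide field_simps)
  qed
  have solve: "\<exists>s\<in>B. z *\<^sub>c s - T s = v \<and> nrm s \<le> K / cmod z / (1 - q) * nrm v" if v: "v \<in> B" for v
  proof -
    let ?v = "inverse z *\<^sub>c v"
    obtain s where s: "s \<in> B" "s - ?T s = ?v" "nrm s \<le> K * nrm ?v / (1 - q)"
      using neumann_solution[OF ban bd' _ le' q, of ?v] v by auto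
    have "z *\<^sub>c (s - ?T s) = v" using s(2) z by simp
    then have "z *\<^sub>c s - T s = v" using z by (simp add: cvec.scale_right_diff_distrib)
    moreover have "nrm s \<le> K / cmod z / (1 - q) * nrm v"
      using s(3) norm_scale[OF v, of "inverse z"] by (simp add: norm_inverse divide_inverse mult_ac)
    ultimately show ?thesis using s(1) by blast
  qed
  have uniq: "v = w" if "v \<in> B" "w \<in> B" "z *\<^sub>c v - T v = z *\<^sub>c w - T w" for v w
  proof -
    let ?d = "v - w"
    have d: "?d \<in> B" using that by simp
    have "z *\<^sub>c ?d - T ?d = (z *\<^sub>c v - T v) - (z *\<^sub>c w - T w)"
      unfolding linear_operator_on_diffD[OF lin subspace that(1,2)] cvec.scale_right_diff_distrib
      by simp
    then have "z *\<^sub>c ?d = T ?d" unfolding that(3) by simp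
    then have fix1: "?T ?d = ?d" using z by (metis cvec.scale_scale cvec.scale_one left_inverse)
    have fixn: "(?T ^^ n) ?d = ?d" for n
      by (induction n) (simp_all only: funpow_0 funpow.simps(2) o_apply fix1)
    have "nrm ?d \<le> K * nrm ?d * q ^ n" for n
      using le'[OF d, of n] fixn by simp
    moreover have "(\<lambda>n. K * nrm ?d * q ^ n) \<longlonglongrightarrow> 0"
      using q by (intro tendsto_mult_right_zero LIMSEQ_power_zero) auto
    ultimately show ?thesis by (rule eq_if_dist_tendsto_0[OF that(1,2)])
  qed
  define R where "R v = (SOME s. s \<in> B \<and> z *\<^sub>c s - T s = v \<and> nrm s \<le> K / cmod z / (1 - q) * nrm v)" for v
  have R: "R v \<in> B" "z *\<^sub>c R v - T (R v) = v" "nrm (R v) \<le> K / cmod z / (1 - q) * nrm v"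
    if "v \<in> B" for v
    using someI_ex[OF solve[OF that, unfolded Bex_def]] unfolding R_def by auto
  have "R (v + w) = R v + R w" if "v \<in> B" "w \<in> B" for v w
  proof (rule uniq)
    have "z *\<^sub>c (R v + R w) - T (R v + R w) = (z *\<^sub>c R v - T (R v)) + (z *\<^sub>c R w - T (R w))"
      using that R(1) by (simp add: linear_operator_on_addD[OF lin] cvec.scale_right_distrib)
    then show "z *\<^sub>c R (v + w) - T (R (v + w)) = z *\<^sub>c (R v + R w) - T (R v + R w)"
      using that R(2) by simp
  qed (use that R(1) in auto)
  moreover have "R (c *\<^sub>c v) = c *\<^sub>c R v" if "v \<in> B" for c v
  proof (rule uniq)
    have "z *\<^sub>c (c *\<^sub>c R v) - T (c *\<^sub>c R v) = c *\<^sub>c (z *\<^sub>c R v - T (R v))"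
      using that R(1)
      by (simp add: linear_operator_on_scaleD[OF lin] cvec.scale_right_diff_distrib mult.commute)
    then show "z *\<^sub>c R (c *\<^sub>c v) - T (R (c *\<^sub>c v)) = z *\<^sub>c (c *\<^sub>c R v) - T (c *\<^sub>c R v)"
      using that R(2) by simp
  qed (use that R(1) in auto)
  ultimately have "bounded_operator_on B nrm R"
    unfolding bounded_operator_on_def linear_operator_on_def using R(1,3) by blast
  moreover have "R (z *\<^sub>c v - T v) = v" if "v \<in> B" for v
  proof -
    have "z *\<^sub>c v - T v \<in> B" using that Tmem by simp
    then show ?thesis by (intro uniq[OF R(1) that] R(2))
  qed
  ultimately show ?thesis unfolding spectrum_on_def using R(2) by blast
qed

lemma spectral_radius_le_if_geometric:
  assumes "banach_space_on B nrm" "bounded_operator_on B nrm T"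
    and "\<And>n v. v \<in> B \<Longrightarrow> nrm ((T ^^ n) v) \<le> K * r ^ n * nrm v" and "0 \<le> r"
  shows "spectral_radius_on B nrm T \<le> ennreal r"
  unfolding spectral_radius_on_def
  using not_in_spectrum_if_geometric[OF assms] by (intro SUP_least ennreal_leI) (meson not_le)

section \<open>Geometric decay from one contracting power\<close>

text \<open>The rate is \<open>r = root N (1/2)\<close>. It is chosen before the sequence \<open>a\<close>, so that one rate serves the
  orbits of all vectors; the factor 2 pays for the indices \<open>n < N\<close>, where only \<open>a n \<le> K\<close> is known.\<close>

lemma geometric_decay_if_halving:
  assumes "N > 0"
  shows "\<exists>r::real. 0 < r \<and> r < 1 \<and>
    (\<forall>a K. (\<forall>n. a (n + N) \<le> a n / 2) \<longrightarrow> (\<forall>n. a n \<le> K) \<longrightarrow> 0 \<le> K \<longrightarrow> (\<forall>n. a n \<le> 2 * K * r ^ n))"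
proof (intro exI conjI allI impI)
  let ?r = "root N (1/2) :: real"
  show r: "0 < ?r" "?r < 1" using assms by (auto simp: real_root_lt_1_iff)
  fix a :: "nat \<Rightarrow> real" and K n
  assume "\<forall>n. a (n + N) \<le> a n / 2" "\<forall>n. a n \<le> K" "0 \<le> K"
  then have half: "\<And>n. a (n + N) \<le> a n / 2" and K: "\<And>n. a n \<le> K" "0 \<le> K"
    by auto
  have rN: "?r ^ N = 1/2" using assms by (simp add: real_root_pow_pos2)
  show "a n \<le> 2 * K * ?r ^ n"
  proof (induction n rule: less_induct)
    case (less n)
    show ?case
    proof (cases "n < N")
      case True
      then have "1/2 \<le> ?r ^ n" using rN r power_decreasing[of n N ?r] by simp
      then have "K * 1 \<le> K * (2 * ?r ^ n)" by (intro mult_left_mono K(2)) simp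
      then show ?thesis using K(1)[of n] by simp
    next
      case False
      then have "a n \<le> a (n - N) / 2" using half[of "n - N"] by simp
      also have "\<dots> \<le> (2 * K * ?r ^ (n - N)) * ?r ^ N"
        using less[of "n - N"] False assms unfolding rN by simp
      also have "\<dots> = 2 * K * ?r ^ n"
        using False by (simp add: mult.assoc flip: power_add)
      finally show ?thesis .
    qed
  qed
qed


section \<open>Uniform decay on the zero average space\<close>

text \<open>The extended real supremum over the weak unit ball becomes an inequality with one constant for
  all vectors and all powers, by homogeneity.\<close>

lemma uniform_weak_bound:
  assumes norm: "normed_space_on W nw" and sub: "csubspace V" "V \<subseteq> W"
    and lin: "linear_operator_on V T"
    and bdd: "(SUP n. restricted_opnorm nw V (T ^^ n)) < \<infinity>"
  obtains M where "0 \<le> M" "\<And>n g. g \<in> V \<Longrightarrow> nw ((T ^^ n) g) \<le> M * nw g"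
proof -
  interpret normed_carrier W nw by unfold_locales fact
  have powmem: "(T ^^ n) g \<in> W" if "g \<in> V" for n g
    using linear_operator_on_memD[OF linear_operator_on_funpow[OF lin] that] sub by auto
  define M where "M = enn2real (SUP n. restricted_opnorm nw V (T ^^ n))"
  have M: "ennreal M = (SUP n. restricted_opnorm nw V (T ^^ n))"
    unfolding M_def using bdd by simp
  have "nw ((T ^^ n) g) \<le> M * nw g" if g: "g \<in> V" for n g
  proof (cases "g = 0")
    case True
    then show ?thesis
      using linear_operator_on_zeroD[OF linear_operator_on_funpow[OF lin] sub(1)] by simp
  next
    case False
    have gW: "g \<in> W" using g sub by auto
    have pos: "0 < nw g" using norm_eq_0_iff[OF gW] norm_nonneg[OF gW] False by linarith
    define c where "c = complex_of_real (1 / nw g)"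
    have cmc: "cmod c = 1 / nw g" using pos by (simp add: c_def norm_divide)
    have cg: "c *\<^sub>c g \<in> {g \<in> V. nw g \<le> 1}"
      using norm_scale[OF gW, of c] pos cvec.subspace_scale[OF sub(1) g] by (simp add: cmc)
    have "ennreal (nw ((T ^^ n) (c *\<^sub>c g))) \<le> restricted_opnorm nw V (T ^^ n)"
      unfolding restricted_opnorm_def by (rule SUP_upper[OF cg])
    also have "\<dots> \<le> ennreal M" unfolding M by (rule SUP_upper) simp
    finally have "nw ((T ^^ n) (c *\<^sub>c g)) \<le> M"
      by (simp add: M_def)
    moreover have "nw ((T ^^ n) (c *\<^sub>c g)) = nw ((T ^^ n) g) / nw g"
      using linear_operator_on_scaleD[OF linear_operator_on_funpow[OF lin] g] norm_scale[OF powmem[OF g]]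
      by (simp add: cmc)
    ultimately show ?thesis using pos by (simp add: field_simps)
  qed
  then show ?thesis using that[of M] by (simp add: M_def)
qed

text \<open>Pointwise convergence of an equicontinuous family is uniform on a totally bounded set. The
  centres of the given nets need not lie in \<open>V\<close>, where alone \<open>T\<close> is controlled, so each useful
  centre is first replaced by a point of \<open>U\<close> near it, which doubles the radius of the net.\<close>

lemma uniform_weak_decay:
  assumes norm: "normed_space_on W nw" and sub: "csubspace V" "V \<subseteq> W"
    and lin: "linear_operator_on V T"
    and M: "0 \<le> M" "\<And>n g. g \<in> V \<Longrightarrow> nw ((T ^^ n) g) \<le> M * nw g"
    and lim: "\<And>g. g \<in> V \<Longrightarrow> (\<lambda>n. nw ((T ^^ n) g)) \<longlonglongrightarrow> 0"
    and U: "U \<subseteq> V"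
    and net: "\<And>\<epsilon>. \<epsilon> > 0 \<Longrightarrow> \<exists>F. finite F \<and> F \<subseteq> W \<and> (\<forall>g\<in>U. \<exists>f\<in>F. nw (g - f) < \<epsilon>)"
    and e: "0 < e"
  shows "\<exists>m. \<forall>g\<in>U. nw ((T ^^ m) g) \<le> e"
proof -
  interpret normed_carrier W nw by unfold_locales fact
  \<comment> \<open>A net point is reached within \<open>2 * d\<close>, and its own orbit is below \<open>d\<close>: in total
    \<open>M * (2 * d) + d = e\<close>.\<close>
  define d where "d = e / (2 * M + 1)"
  have d: "0 < d" using e M(1) by (simp add: d_def)
  obtain F where F: "finite F" "F \<subseteq> W" "\<And>g. g \<in> U \<Longrightarrow> \<exists>f\<in>F. nw (g - f) < d"
    using net[OF d] by blast
  define p where "p f = (SOME h. h \<in> U \<and> nw (h - f) < d)" for f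
  have p: "p f \<in> U" "nw (p f - f) < d" if "g \<in> U" "nw (g - f) < d" for f g
    using someI[of "\<lambda>h. h \<in> U \<and> nw (h - f) < d" g] that unfolding p_def by auto
  define G where "G = p ` F \<inter> U"
  have "\<forall>\<^sub>F n in sequentially. \<forall>h\<in>G. nw ((T ^^ n) h) < d"
    unfolding G_def using F(1) U
    by (intro eventually_ball_finite) (auto intro!: order_tendstoD(2)[OF lim d])
  then obtain m where m: "\<And>h. h \<in> G \<Longrightarrow> nw ((T ^^ m) h) < d"
    by (auto simp: eventually_sequentially)
  have "nw ((T ^^ m) g) \<le> e" if g: "g \<in> U" for g
  proof -
    obtain f where f: "f \<in> F" "nw (g - f) < d" using F(3)[OF g] by blast
    let ?h = "p f"
    note h = p[OF g f(2)]
    have hG: "?h \<in> G" using h f by (auto simp: G_def)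
    have gV: "g \<in> V" "?h \<in> V" using g h U by auto
    have mem: "g \<in> W" "?h \<in> W" "f \<in> W" using gV sub f F by auto
    have dV: "g - ?h \<in> V" using gV cvec.subspace_diff[OF sub(1)] by auto
    have dist: "nw (g - ?h) \<le> 2 * d"
      using norm_triangle[of g f ?h] norm_minus_commute[of f ?h] mem h f by simp
    note powlin = linear_operator_on_funpow[OF lin, of m]
    have pmem: "(T ^^ m) g \<in> W" "(T ^^ m) ?h \<in> W"
      using linear_operator_on_memD[OF powlin] gV sub by auto
    have "nw ((T ^^ m) g) \<le> nw ((T ^^ m) ?h) + nw ((T ^^ m) (g - ?h))"
      using norm_le_add_dist[OF pmem] linear_operator_on_diffD[OF powlin sub(1) gV] by simp
    also have "\<dots> \<le> d + M * (2 * d)"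
      using m[OF hG] M(2)[OF dV, of m] mult_left_mono[OF dist M(1)] by linarith
    also have "\<dots> = d * (2 * M + 1)" by (simp add: algebra_simps)
    also have "\<dots> = e" using M(1) by (simp add: d_def)
    finally show ?thesis .
  qed
  then show ?thesis by blast
qed

text \<open>Run \<open>m\<close> steps until the weak norm is small on the strong unit ball, then \<open>k\<close> steps of the
  Lasota-Yorke inequality until the strong term is small: the strong norm is bounded by \<open>A q\<^sup>k (A + B)\<close>
  plus \<open>B\<close> times the weak norm after \<open>m\<close> steps, and each part is made at most \<open>1/4\<close>.\<close>

lemma halving_power:
  assumes norm: "normed_space_on V ns" and lin: "linear_operator_on V T"
    and ranges: "0 \<le> A" "0 \<le> B" "0 \<le> q" "q < 1"
    and ly: "\<And>g n. g \<in> V \<Longrightarrow> ns ((T ^^ n) g) \<le> A * q ^ n * ns g + B * nw g"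
    and le: "\<And>g. g \<in> V \<Longrightarrow> nw g \<le> ns g"
    and wscale: "\<And>c g. g \<in> V \<Longrightarrow> nw (c *\<^sub>c g) = cmod c * nw g"
    and decay: "\<And>e. 0 < e \<Longrightarrow> \<exists>m. \<forall>g\<in>{g\<in>V. ns g \<le> 1}. nw ((T ^^ m) g) \<le> e"
  shows "\<exists>N>0. \<forall>g\<in>V. ns ((T ^^ N) g) \<le> ns g / 2"
proof -
  interpret normed_carrier V ns by unfold_locales fact
  have mem: "(T ^^ n) g \<in> V" if "g \<in> V" for n g
    using linear_operator_on_memD[OF linear_operator_on_funpow[OF lin] that] .
  have "(\<lambda>n. A * (A + B) * q ^ n) \<longlonglongrightarrow> 0"
    using ranges by (intro tendsto_mult_right_zero LIMSEQ_power_zero) auto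
  from order_tendstoD(2)[OF this, of "1/4"] obtain k0
    where k0: "\<And>n. n \<ge> k0 \<Longrightarrow> A * (A + B) * q ^ n < 1/4"
    by (auto simp: eventually_sequentially)
  \<comment> \<open>The successor makes \<open>k + m\<close> positive.\<close>
  define k where "k = Suc k0"
  have k: "A * (A + B) * q ^ k < 1/4" using k0[of k] by (simp add: k_def)
  \<comment> \<open>\<open>B + 1\<close> instead of \<open>B\<close>, which may vanish.\<close>
  obtain m where m: "\<And>g. g \<in> V \<Longrightarrow> ns g \<le> 1 \<Longrightarrow> nw ((T ^^ m) g) \<le> 1 / (4 * (B + 1))"
    using decay[of "1 / (4 * (B + 1))"] ranges by auto
  have weak: "B * nw ((T ^^ m) g) \<le> ns g / 4" if g: "g \<in> V" for g
  proof (cases "ns g = 0")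
    case True
    then have "g = 0" using norm_eq_0_iff g by simp
    then have "(T ^^ m) g = 0"
      using linear_operator_on_zeroD[OF linear_operator_on_funpow[OF lin] subspace] by simp
    then have "nw ((T ^^ m) g) \<le> 0" using le[of 0] by simp
    then show ?thesis using True ranges by (simp add: mult_nonneg_nonpos)
  next
    case False
    then have pos: "0 < ns g" using norm_nonneg[OF g] by linarith
    define c where "c = complex_of_real (1 / ns g)"
    have cmc: "cmod c = 1 / ns g" using pos by (simp add: c_def norm_divide)
    have "nw ((T ^^ m) (c *\<^sub>c g)) \<le> 1 / (4 * (B + 1))"
      using m[of "c *\<^sub>c g"] g norm_scale[OF g, of c] pos by (simp add: cmc)
    then have "nw ((T ^^ m) g) / ns g \<le> 1 / (4 * (B + 1))"
      using linear_operator_on_scaleD[OF linear_operator_on_funpow[OF lin] g] wscale[OF mem[OF g]]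
      by (simp add: cmc)
    then have "nw ((T ^^ m) g) \<le> 1 / (4 * (B + 1)) * ns g"
      using pos by (simp add: pos_divide_le_eq)
    then have "B * nw ((T ^^ m) g) \<le> B * (1 / (4 * (B + 1)) * ns g)"
      using ranges by (intro mult_left_mono)
    also have "\<dots> = B / (B + 1) * (ns g / 4)" using ranges by (simp add: field_simps)
    also have "\<dots> \<le> 1 * (ns g / 4)" using ranges pos by (intro mult_right_mono) auto
    finally show ?thesis by simp
  qed
  have "ns ((T ^^ (k + m)) g) \<le> ns g / 2" if g: "g \<in> V" for g
  proof -
    have "ns ((T ^^ m) g) \<le> A * q ^ m * ns g + B * nw g" by (rule ly[OF g])
    also have "\<dots> \<le> A * 1 * ns g + B * ns g"
      using ranges le[OF g] norm_nonneg[OF g]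
      by (intro add_mono mult_right_mono mult_left_mono power_le_one) auto
    finally have "ns ((T ^^ m) g) \<le> (A + B) * ns g" by (simp add: algebra_simps)
    then have strong: "A * q ^ k * ns ((T ^^ m) g) \<le> A * q ^ k * ((A + B) * ns g)"
      using ranges by (intro mult_left_mono) auto
    have "ns ((T ^^ (k + m)) g) \<le> A * q ^ k * ns ((T ^^ m) g) + B * nw ((T ^^ m) g)"
      using ly[OF mem[OF g], of k m] by (simp add: funpow_add)
    also have "\<dots> \<le> (A * (A + B) * q ^ k) * ns g + ns g / 4"
      using strong weak[OF g] by (simp add: algebra_simps)
    also have "\<dots> \<le> 1/4 * ns g + ns g / 4"
      using k norm_nonneg[OF g] by (intro add_mono mult_right_mono) auto
    finally show ?thesis by simp
  qed
  moreover have "0 < k + m" by (simp add: k_def)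
  ultimately show ?thesis by blast
qed

section \<open>From decay on the zero average space to the spectral gap\<close>

lemma csubspace_zero_average: "csubspace B \<Longrightarrow> csubspace (zero_average B)"
  by (auto simp: cvec.subspace_def zero_average_def cscale_def)

lemma normed_space_on_subspace:
  "normed_space_on B nrm \<Longrightarrow> csubspace V \<Longrightarrow> V \<subseteq> B \<Longrightarrow> normed_space_on V nrm"
  by (simp add: normed_space_on_def subset_eq)

text \<open>Only closedness is at stake, and it does not come from continuity of \<open>g \<mapsto> g UNIV\<close>.
  A limit \<open>g\<close> of zero average vectors inherits the decay bound, because the powers of \<open>T\<close> are uniformly
  bounded. Hence \<open>g\<close> lies in the range of \<open>I - T\<close>, and mass preservation forces \<open>g UNIV = 0\<close>.\<close>

lemma banach_zero_average:
  assumes ban: "banach_space_on B nrm" and bd: "bounded_operator_on B nrm T"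
    and mass: "\<And>v. v \<in> B \<Longrightarrow> T v UNIV = v UNIV"
    and pb: "\<And>n v. v \<in> B \<Longrightarrow> nrm ((T ^^ n) v) \<le> C * nrm v"
    and decay: "\<And>n v. v \<in> zero_average B \<Longrightarrow> nrm ((T ^^ n) v) \<le> D * r ^ n * nrm v"
    and r: "0 \<le> r" "r < 1"
  shows "banach_space_on (zero_average B) nrm"
  unfolding banach_space_on_def
proof (intro conjI allI impI)
  interpret normed_carrier B nrm
    by unfold_locales (use ban in \<open>simp add: banach_space_on_def\<close>)
  have lin: "linear_operator_on B T" using bd by (simp add: bounded_operator_on_def)
  have sub: "zero_average B \<subseteq> B" by (auto simp: zero_average_def)
  show "normed_space_on (zero_average B) nrm"
    by (rule normed_space_on_subspace[OF normed csubspace_zero_average[OF subspace] sub])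
  fix u :: "nat \<Rightarrow> 'a set_fun"
  assume u: "\<forall>n. u n \<in> zero_average B"
    and "\<forall>e>0. \<exists>N. \<forall>m\<ge>N. \<forall>n\<ge>N. nrm (u m - u n) < e"
  then obtain g where g: "g \<in> B" and lim: "(\<lambda>n. nrm (u n - g)) \<longlonglongrightarrow> 0"
    using ban sub unfolding banach_space_on_def by (metis subsetD)
  have uB: "u k \<in> B" for k using u sub by auto
  have powmem: "(T ^^ n) v \<in> B" if "v \<in> B" for n v
    using linear_operator_on_memD[OF linear_operator_on_funpow[OF lin] that] .
  \<comment> \<open>Compare the orbits of \<open>g\<close> and \<open>u k\<close> for fixed \<open>n\<close>, then let \<open>k\<close> tend to infinity.\<close>
  have "nrm ((T ^^ n) g) \<le> (D * nrm g) * r ^ n" for n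
  proof -
    have "nrm ((T ^^ n) g) \<le> D * r ^ n * nrm g + (\<bar>D * r ^ n\<bar> + C) * nrm (u k - g)" for k
    proof -
      have "nrm ((T ^^ n) g) \<le> nrm ((T ^^ n) (u k)) + nrm ((T ^^ n) (g - u k))"
        using norm_le_add_dist[OF powmem[OF g] powmem[OF uB], of n n k]
          linear_operator_on_diffD[OF linear_operator_on_funpow[OF lin] subspace g uB] by simp
      moreover have "nrm ((T ^^ n) (g - u k)) \<le> C * nrm (u k - g)"
        using pb[of "g - u k" n] g uB[of k] norm_minus_commute[of g "u k"] by simp
      moreover have "nrm ((T ^^ n) (u k)) \<le> D * r ^ n * nrm (u k)"
        using decay u by blast
      moreover have "D * r ^ n * nrm (u k) \<le> D * r ^ n * nrm g + \<bar>D * r ^ n\<bar> * nrm (u k - g)"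
      proof -
        have "D * r ^ n * (nrm (u k) - nrm g) \<le> \<bar>D * r ^ n\<bar> * \<bar>nrm (u k) - nrm g\<bar>"
          by (metis abs_ge_self abs_mult)
        also have "\<dots> \<le> \<bar>D * r ^ n\<bar> * nrm (u k - g)"
          using norm_le_add_dist[OF uB[of k] g] norm_le_add_dist[OF g uB[of k]]
            norm_minus_commute[OF g uB[of k]]
          by (intro mult_left_mono) auto
        finally show ?thesis by (simp add: algebra_simps)
      qed
      ultimately show ?thesis unfolding distrib_right by linarith
    qed
    moreover have "(\<lambda>k. D * r ^ n * nrm g + (\<bar>D * r ^ n\<bar> + C) * nrm (u k - g))
        \<longlonglongrightarrow> D * r ^ n * nrm g + (\<bar>D * r ^ n\<bar> + C) * 0"
      by (intro tendsto_intros lim)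
    ultimately have "nrm ((T ^^ n) g) \<le> D * r ^ n * nrm g + (\<bar>D * r ^ n\<bar> + C) * 0"
      by (intro LIMSEQ_le_const) auto
    then show ?thesis by (simp add: algebra_simps)
  qed
  then obtain s where "s \<in> B" "s - T s = g"
    using neumann_solution[OF ban bd g _ r] by blast
  then have "g UNIV = 0" using mass[of s] by auto
  with g lim show "\<exists>v\<in>zero_average B. (\<lambda>n. nrm (u n - v)) \<longlonglongrightarrow> 0"
    by (auto simp: zero_average_def)
qed

text \<open>The eigenvalue is 1, the projection is \<open>P g = g(X) h\<close> for the invariant \<open>h\<close> of mass 1, and the
  remainder \<open>N = T - P\<close> is \<open>T\<close> composed with the projection \<open>I - P\<close> onto the zero average space.\<close>

lemma spectral_gap_if_decay_on_zero_average:
  assumes ban: "banach_space_on B nrm" and bd: "bounded_operator_on B nrm T"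
    and mass: "\<And>v. v \<in> B \<Longrightarrow> T v UNIV = v UNIV"
    and nondeg: "\<exists>g\<in>B. g UNIV \<noteq> 0"
    and pb: "\<And>n v. v \<in> B \<Longrightarrow> nrm ((T ^^ n) v) \<le> C * nrm v"
    and decay: "\<And>n v. v \<in> zero_average B \<Longrightarrow> nrm ((T ^^ n) v) \<le> D * r ^ n * nrm v"
    and r: "0 < r" "r < 1" and D: "0 \<le> D"
  shows "has_spectral_gap B nrm T"
proof -
  interpret normed_carrier B nrm
    by unfold_locales (use ban in \<open>simp add: banach_space_on_def\<close>)
  let ?V = "zero_average B"
  have lin: "linear_operator_on B T" using bd by (simp add: bounded_operator_on_def)
  note powlin = linear_operator_on_funpow[OF lin]
  have powmem: "(T ^^ n) v \<in> B" if "v \<in> B" for n v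
    using linear_operator_on_memD[OF powlin that] .
  have Tmem: "T v \<in> B" if "v \<in> B" for v using linear_operator_on_memD[OF lin that] .
  have sub: "?V \<subseteq> B" by (auto simp: zero_average_def)
  have banV: "banach_space_on ?V nrm"
    using banach_zero_average[OF ban bd mass pb decay] r by auto
  have bdV: "bounded_operator_on ?V nrm T"
    using bd mass sub unfolding bounded_operator_on_def linear_operator_on_def
    by (auto simp: zero_average_def)

  obtain h where h: "h \<in> B" "h UNIV = 1" "T h = h"
  proof -
    obtain g1 where g1: "g1 \<in> B" "g1 UNIV \<noteq> 0" using nondeg by blast
    define g0 where "g0 = inverse (g1 UNIV) *\<^sub>c g1"
    have g0: "g0 \<in> B" "g0 UNIV = 1" using g1 by (auto simp: g0_def) (simp add: cscale_def)
    have w: "T g0 - g0 \<in> ?V" using g0 Tmem mass by (simp add: zero_average_def)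
    have "nrm ((T ^^ n) (T g0 - g0)) \<le> (D * nrm (T g0 - g0)) * r ^ n" for n
      using decay[OF w, of n] by (simp add: algebra_simps)
    \<comment> \<open>Solving inside \<open>?V\<close> rather than in \<open>B\<close> keeps the mass of \<open>g0 + s\<close> equal to 1.\<close>
    then obtain s where s: "s \<in> ?V" "s - T s = T g0 - g0"
      using neumann_solution[OF banV bdV w] r by (meson less_imp_le)
    have sB: "s \<in> B" "s UNIV = 0" using s by (auto simp: zero_average_def)
    have "T (g0 + s) = T g0 + T s" by (rule linear_operator_on_addD[OF lin g0(1) sB(1)])
    also have "\<dots> = g0 + s + ((T g0 - g0) - (s - T s))" by simp
    also have "\<dots> = g0 + s" unfolding s(2) by simp
    finally show ?thesis using that[of "g0 + s"] g0 sB by simp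
  qed
  have hn: "(T ^^ n) h = h" for n by (induction n) (use h in auto)

  define P where "P g = g UNIV *\<^sub>c h" for g :: "'a set_fun"
  define N where "N g = T g - P g" for g :: "'a set_fun"
  have Pmem: "P g \<in> B" for g using h by (simp add: P_def)
  have Pmass: "P g UNIV = g UNIV" for g using h by (simp add: P_def cscale_def)
  have PV: "g - P g \<in> ?V" if "g \<in> B" for g
    using that Pmem Pmass by (simp add: zero_average_def)
  have TP: "T (P g) = P g" for g
    using linear_operator_on_scaleD[OF lin h(1)] h by (simp add: P_def)
  have TnP: "(T ^^ n) (P g) = P g" for g n by (induction n) (use TP in auto)
  have P_T: "P (T g) = P g" if "g \<in> B" for g using mass[OF that] by (simp add: P_def)
  have PP: "P (P g) = P g" for g using Pmass by (simp add: P_def)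
  have Plin: "linear_operator_on B P"
    unfolding linear_operator_on_def using Pmem
    by (auto simp: P_def cvec.scale_left_distrib) (simp add: cscale_def mult.assoc)
  have Pdiff: "P (v - w) = P v - P w" if "v \<in> B" "w \<in> B" for v w
    by (rule linear_operator_on_diffD[OF Plin subspace that])

  \<comment> \<open>\<open>P g\<close> is the limit of \<open>(T ^^ n) g\<close>, so it inherits the uniform bound \<open>C\<close> on the powers.\<close>
  have Pbound: "nrm (P g) \<le> C * nrm g" if g: "g \<in> B" for g
  proof -
    have gV: "g - P g \<in> B" using PV[OF g] sub by auto
    have "nrm (P g) \<le> C * nrm g + D * r ^ n * nrm (g - P g)" for n
    proof -
      have "P g = (T ^^ n) g - (T ^^ n) (g - P g)"
        using linear_operator_on_diffD[OF powlin subspace g Pmem] TnP by simp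
      then have "nrm (P g) \<le> nrm ((T ^^ n) g) + nrm ((T ^^ n) (g - P g))"
        using norm_diff[OF powmem[OF g] powmem[OF gV], of n n] by simp
      then show ?thesis using pb[OF g, of n] decay[OF PV[OF g], of n] by simp
    qed
    moreover have "(\<lambda>n. C * nrm g + D * r ^ n * nrm (g - P g)) \<longlonglongrightarrow> C * nrm g + D * 0 * nrm (g - P g)"
      using r by (intro tendsto_intros LIMSEQ_power_zero) auto
    ultimately have "nrm (P g) \<le> C * nrm g + D * 0 * nrm (g - P g)"
      by (intro LIMSEQ_le_const) auto
    then show ?thesis by simp
  qed
  then have Pbd: "bounded_operator_on B nrm P" using Plin by (auto simp: bounded_operator_on_def)

  have Nlin: "linear_operator_on B N"
    unfolding linear_operator_on_def N_def
    using linear_operator_on_addD[OF lin] linear_operator_on_addD[OF Plin]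
      linear_operator_on_scaleD[OF lin] linear_operator_on_scaleD[OF Plin] Tmem Pmem
    by (auto simp: cvec.scale_right_diff_distrib)
  have N_eq: "N g = T (g - P g)" if "g \<in> B" for g
    using linear_operator_on_diffD[OF lin subspace that Pmem] TP by (simp add: N_def)
  have PN: "P (N g) = 0" if "g \<in> B" for g
    using Pdiff[OF Tmem[OF that] Pmem] P_T[OF that] PP by (simp add: N_def)
  have NP: "N (P g) = 0" for g using TP PP by (simp add: N_def)
  \<comment> \<open>The formula fails for exponent 0, where \<open>N ^^ 0\<close> is the identity; the summand 1 in the
    constant \<open>K\<close> below covers that case.\<close>
  have Npow: "(N ^^ Suc n) g = (T ^^ Suc n) (g - P g)" if g: "g \<in> B" for n g
  proof (induction n)
    case (Suc n)
    have "P ((N ^^ Suc n) g) = 0"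
      using PN linear_operator_on_memD[OF linear_operator_on_funpow[OF Nlin] g] by simp
    then have "N ((N ^^ Suc n) g) = T ((N ^^ Suc n) g)" by (simp add: N_def)
    with Suc show ?case by simp
  qed (simp only: funpow.simps comp_id N_eq[OF g])
  have C: "nrm (g - P g) \<le> (1 + C) * nrm g" if "g \<in> B" for g
    using norm_diff[OF that Pmem, of g] Pbound[OF that] by (simp add: algebra_simps)
  define K where "K = 1 + \<bar>D * (1 + C)\<bar>"
  have Nbound: "nrm ((N ^^ n) g) \<le> K * r ^ n * nrm g" if g: "g \<in> B" for n g
  proof (cases n)
    case 0
    have "1 * nrm g \<le> K * nrm g" using norm_nonneg[OF g] by (intro mult_right_mono) (auto simp: K_def)
    with 0 show ?thesis by simp
  next
    case (Suc k)
    have "nrm ((N ^^ n) g) \<le> D * r ^ n * nrm (g - P g)"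
      using Npow[OF g, of k] decay[OF PV[OF g], of n] Suc by simp
    also have "\<dots> \<le> D * r ^ n * ((1 + C) * nrm g)"
      using r D C[OF g] by (intro mult_left_mono) auto
    also have "\<dots> = D * (1 + C) * (r ^ n * nrm g)" by simp
    also have "\<dots> \<le> K * (r ^ n * nrm g)"
      using r norm_nonneg[OF g] by (intro mult_right_mono) (auto simp: K_def)
    finally show ?thesis by simp
  qed
  have Nbd: "bounded_operator_on B nrm N"
    using Nlin Nbound[of _ 1] unfolding bounded_operator_on_def by (auto intro!: exI[of _ "K * r"])
  have "spectral_radius_on B nrm N \<le> ennreal r"
    by (rule spectral_radius_le_if_geometric[OF ban Nbd Nbound]) (use r in auto)
  also have "\<dots> < ennreal (cmod 1)" using r by (simp add: ennreal_lessI)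
  finally have rad: "spectral_radius_on B nrm N < ennreal (cmod 1)" .

  have span: "P ` B = cvec.span {h}"
    unfolding cvec.span_singleton
  proof
    show "P ` B \<subseteq> range (\<lambda>k. k *\<^sub>c h)" by (auto simp: P_def)
    have "P (c *\<^sub>c h) = c *\<^sub>c h" for c using h by (simp add: P_def cscale_def)
    then show "range (\<lambda>k. k *\<^sub>c h) \<subseteq> P ` B"
      using scale_mem[OF h(1)] by (metis image_eqI image_subsetI)
  qed
  have "\<not> cvec.dependent {h}" using h by (auto simp: cvec.dependent_single)
  then have "cdim (P ` B) = card {h}"
    unfolding span by (rule cvec.dim_span_eq_card_independent)
  then have "cdim (P ` B) = 1" by simp
  moreover have "T v = 1 *\<^sub>c P v + N v" for v by (simp add: N_def)
  ultimately show ?thesis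
    unfolding has_spectral_gap_def
    using Pbd Nbd PP PN NP rad by (intro exI[of _ 1] exI[of _ P] exI[of _ N]) auto
qed

section \<open>The spectral gap theorem\<close>

theorem theorem31:
  fixes Bs Bw :: "'a::metric_space set_fun set"
    and ns nw :: "'a set_fun \<Rightarrow> real"
    and L :: "'a set_fun \<Rightarrow> 'a set_fun"
  assumes spaces: "normed_space_on Bs ns" "normed_space_on Bw nw"
      "Bs \<subseteq> Bw" "Bw \<subseteq> complex_measures"
    and norms: "\<forall>g\<in>Bs. nw g \<le> ns g"
    and markov: "markov_operator_on Bw L" "\<forall>g\<in>Bs. L g \<in> Bs"
    and nondegenerate: "\<exists>g\<in>Bs. g UNIV \<noteq> 0"
    and lasota_yorke: "\<exists>A B lam1 :: real. 0 \<le> A \<and> 0 \<le> B \<and> 0 \<le> lam1 \<and> lam1 < 1 \<and>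
      (\<forall>g\<in>Bs. \<forall>n. ns ((L ^^ n) g) \<le> A * lam1 ^ n * ns g + B * nw g)"
    and equilibrium: "\<forall>g\<in>zero_average Bs. (\<lambda>n. nw ((L ^^ n) g)) \<longlonglongrightarrow> 0"
    and compact_inclusion: "\<forall>\<epsilon>>0. \<exists>F. finite F \<and> F \<subseteq> zero_average Bw \<and>
      (\<forall>g\<in>zero_average Bs. ns g \<le> 1 \<longrightarrow> (\<exists>f\<in>F. nw (g - f) < \<epsilon>))"
    and weak_boundedness: "(SUP n. restricted_opnorm nw (zero_average Bs) (L ^^ n)) < \<infinity>"
    and banach: "banach_space_on Bs ns"
  shows "has_spectral_gap Bs ns L"
proof -
  interpret s: normed_carrier Bs ns by unfold_locales (rule spaces)
  interpret w: normed_carrier Bw nw by unfold_locales (rule spaces)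
  let ?V = "zero_average Bs"
  have VBs: "?V \<subseteq> Bs" by (auto simp: zero_average_def)
  then have VBw: "?V \<subseteq> Bw" using spaces(3) by blast
  have Vsub: "csubspace ?V" by (rule csubspace_zero_average[OF s.subspace])
  have Vnorm: "normed_space_on ?V ns" by (rule normed_space_on_subspace[OF spaces(1) Vsub VBs])
  have mass: "L g UNIV = g UNIV" if "g \<in> Bs" for g
    using markov(1) that spaces(3) by (auto simp: markov_operator_on_def)
  have lin: "linear_operator_on Bs L"
    using markov spaces(3) unfolding markov_operator_on_def linear_operator_on_def
    by (meson subsetD)
  have linV: "linear_operator_on ?V L"
    using lin mass unfolding linear_operator_on_def by (auto simp: zero_average_def)
  obtain A B q where ranges: "0 \<le> A" "0 \<le> B" "0 \<le> q" "q < 1"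
    and ly: "\<And>g n. g \<in> Bs \<Longrightarrow> ns ((L ^^ n) g) \<le> A * q ^ n * ns g + B * nw g"
    using lasota_yorke by blast
  have pb: "ns ((L ^^ n) g) \<le> (A + B) * ns g" if g: "g \<in> Bs" for n g
  proof -
    have "ns ((L ^^ n) g) \<le> A * q ^ n * ns g + B * nw g" by (rule ly[OF g])
    also have "\<dots> \<le> A * 1 * ns g + B * ns g"
      using ranges norms g s.norm_nonneg[OF g]
      by (intro add_mono mult_right_mono mult_left_mono power_le_one) auto
    finally show ?thesis by (simp add: algebra_simps)
  qed
  have bd: "bounded_operator_on Bs ns L"
    using lin pb[of _ 1] unfolding bounded_operator_on_def by auto
  obtain M where M: "0 \<le> M" "\<And>n g. g \<in> ?V \<Longrightarrow> nw ((L ^^ n) g) \<le> M * nw g"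
    by (rule uniform_weak_bound[OF spaces(2) Vsub VBw linV weak_boundedness]) (rule that)
  have net: "\<exists>F. finite F \<and> F \<subseteq> Bw \<and> (\<forall>g\<in>{g\<in>?V. ns g \<le> 1}. \<exists>f\<in>F. nw (g - f) < \<epsilon>)"
    if pos: "\<epsilon> > 0" for \<epsilon>
  proof -
    obtain F where "finite F" "F \<subseteq> zero_average Bw"
      "\<forall>g\<in>?V. ns g \<le> 1 \<longrightarrow> (\<exists>f\<in>F. nw (g - f) < \<epsilon>)"
      using compact_inclusion[rule_format, OF pos] by blast
    then have "finite F \<and> F \<subseteq> Bw \<and> (\<forall>g\<in>{g\<in>?V. ns g \<le> 1}. \<exists>f\<in>F. nw (g - f) < \<epsilon>)"
      by (simp add: zero_average_def subset_eq)
    then show ?thesis by blast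
  qed
  have weak_decay: "\<exists>m. \<forall>g\<in>{g\<in>?V. ns g \<le> 1}. nw ((L ^^ m) g) \<le> e" if "0 < e" for e
    by (rule uniform_weak_decay[OF spaces(2) Vsub VBw linV M _ _ net that])
      (use equilibrium in auto)
  have "\<exists>N>0. \<forall>g\<in>?V. ns ((L ^^ N) g) \<le> ns g / 2"
  proof (rule halving_power[OF Vnorm linV ranges _ _ _ weak_decay])
    fix g assume "g \<in> ?V"
    then have g: "g \<in> Bs" "g \<in> Bw" using VBs VBw by auto
    show "ns ((L ^^ n) g) \<le> A * q ^ n * ns g + B * nw g" for n by (rule ly[OF g(1)])
    show "nw g \<le> ns g" using norms g(1) by blast
    show "nw (c *\<^sub>c g) = cmod c * nw g" for c by (rule w.norm_scale[OF g(2)])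
  qed
  then obtain N where N: "N > 0" "\<And>g. g \<in> ?V \<Longrightarrow> ns ((L ^^ N) g) \<le> ns g / 2"
    by blast
  obtain r :: real where r: "0 < r" "r < 1" and decay:
    "\<forall>a K. (\<forall>n. a (n + N) \<le> a n / 2) \<longrightarrow> (\<forall>n. a n \<le> K) \<longrightarrow> 0 \<le> K \<longrightarrow> (\<forall>n. a n \<le> 2 * K * r ^ n)"
    using geometric_decay_if_halving[OF N(1)] by blast
  have geometric: "ns ((L ^^ n) g) \<le> 2 * (A + B) * r ^ n * ns g" if g: "g \<in> ?V" for n g
  proof -
    have gB: "g \<in> Bs" using g VBs by auto
    have "ns ((L ^^ n) g) \<le> 2 * ((A + B) * ns g) * r ^ n"
    proof (rule decay[rule_format])
      show "ns ((L ^^ (k + N)) g) \<le> ns ((L ^^ k) g) / 2" for k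
        using N(2)[OF linear_operator_on_memD[OF linear_operator_on_funpow[OF linV] g], of k]
        by (simp add: funpow_add add.commute[of k])
    qed (use pb gB ranges s.norm_nonneg[OF gB] in auto)
    then show ?thesis by (simp add: mult_ac)
  qed
  show ?thesis
    by (rule spectral_gap_if_decay_on_zero_average[OF banach bd mass nondegenerate pb geometric r])
      (use ranges in auto)
qed

end
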